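(* Let $G$ be any (possibly infinite) graph, and let $\mathcal{B}$ be a set of separable blocks in $G$. Suppose that $G$ has a tight tree-decomposition $(\tilde{T}, \tilde{\mathcal{V}})$ that distinguishes all the blocks in $\mathcal{B}$ (i.e. distinguishes every two distinct blocks in $\mathcal{B}$). Then there exists a tree-decomposition $(T, \mathcal{V})$ of $G$ that refines $(\tilde{T}, \tilde{\mathcal{V}})$ and is such that every block in $\mathcal{B}$ is equal to the unique bag of $(T, \mathcal{V})$ that contains it. Moreover, $(T, \mathcal{V})$ is canonical if $\mathcal{B}$ and $(\tilde{T}, \tilde{\mathcal{V}})$ are canonical.
   Context: All graphs may be infinite. Separations. A separation of a graph $G$ is a set $\{A,B\}$ of subsets of $V(G)$ with $A \cup B = V(G)$ and no edge of $G$ between $A \setminus B$ and $B \setminus A$; its order is $|A \cap B|$. Its orientations are the oriented separations $(A,B)$ and $(B,A)$. $\{A,B\}$ is tight if both $G[A \setminus B]$ and $G[B \setminus A]$ contain a component of $G - (A \cap B)$ whose neighbourhood in $G$ equals $A \cap B$. For $k \in \mathbb{N} \cup \{\aleph_0\}$, $S_k(G)$ is the set of all separations of $G$ of order $< k$, and $\vec{S}_k(G)$ is the set of all their orientations. Oriented separations are partially ordered by $(A,B) \leq (C,D)$ iff $A \subseteq C$ and $B \supseteq D$. A star is a set $\sigma \subseteq \vec{S}_{\aleph_0}(G) \setminus \{(V(G),V(G))\}$ such that $(A,B) \leq (D,C)$ for any two distinct $(A,B),(C,D) \in \sigma$. Its interior is $\operatorname{int}(\sigma) = \bigcap_{(A,B)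 \in \sigma} B$ (with $\operatorname{int}(\emptyset) = V(G)$). Blocks. For $k \in \mathbb{N}$, a $k$-block in $G$ is a maximal set $b$ of at least $k$ vertices such that no two vertices $v,w \in b$ can be separated in $G$ by removing fewer than $k$ vertices other than $v,w$. A block is a $k$-block for some $k \in \mathbb{N}$. A $k$-block $b$ is separable if there is a star $\sigma \subseteq \vec{S}_k(G)$ with $\operatorname{int}(\sigma) = b$. Every $k$-block $b$ induces an orientation (in fact a $k$-profile) of $S_k(G)$ by orienting $\{A,B\} \in S_k(G)$ as $(A,B)$ if and only if $b \subseteq B$. Tree-decompositions. A tree-decomposition of $G$ is a pair $(T,\mathcal{V})$ of a (possibly infinite) tree $T$ and a family $\mathcal{V} = (V_t)_{t \in V(T)}$ of subsets of $V(G)$ (the bags) such that $\bigcup_{t} G[V_t] = G$ and for every $v \in V(G)$ the graph $T[\{t : v \in V_t\}]$ is connected. An edge $e = \{t_1,t_2\}$ of $T$ induces the separation $\{U_1,U_2\}$ of $G$, where $U_i = \bigcup_{s \in V(T_i)} V_s$ and $T_i \ni t_i$ are the two components of $T - e$. $(T,\mathcal{V})$ is tight if every separation induced by an edge of $T$ is tight. $(T,\mathcal{V})$ distinguishes two blocks if some edge of $T$ induces a separation that the orientations (profiles) induced by the two blocks orient differently. $(T,\mathcal{V})$ refines $(\tilde{T},\tilde{\mathcal{V}})$ if the set of separations induced by the edges of $T$ is a superset of the set of separations induced by the edges of $\tilde{T}$. Canonicity. A tree-decomposition $(T,\mathcal{V})$ of $G$ is canonical if the construction $\Psi$ of it commutes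 with all isomorphisms $\varphi: G \to G'$: with $(T,\mathcal{V}) = \Psi(G)$ and $(T',\mathcal{V}') = \Psi(G')$, $\varphi$ maps the bags $V_t$ to bags $V'_{t'}$ in such a way that $t \mapsto t'$ is an isomorphism $T \to T'$. Likewise, a set $\mathcal{B}$ of blocks is canonical if it is given by an assignment $G \mapsto \mathcal{B}(G)$ with $\varphi(\mathcal{B}(G)) = \mathcal{B}(G')$ for every isomorphism $\varphi: G \to G'$.
   Formalization: It is additionally assumed that every block in B is contained in exactly one bag of the given tree-decomposition; without this the claim fails, e.g. for the 1-block V(G) of the path 0-1-2 with bags {0,1}, {1,2}. *)

theory Defs
  imports Main "HOL-Library.Extended_Nat"
begin

section \<open>Graphs\<close>

text \<open>The undirected graphs of the AFP entry Graph_Theory are finite, and trees there are directed,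
  so simple graphs of arbitrary size are introduced here.\<close>

record 'a ugraph =
  verts :: "'a set"
  edges :: "'a set set"

definition is_graph :: "'a ugraph \<Rightarrow> bool" where
  "is_graph G \<longleftrightarrow> (\<forall>e\<in>edges G. e \<subseteq> verts G \<and> card e = 2)"

definition adj :: "'a ugraph \<Rightarrow> 'a \<Rightarrow> 'a \<Rightarrow> bool" where
  "adj G u v \<longleftrightarrow> {u, v} \<in> edges G"

definition induced :: "'a ugraph \<Rightarrow> 'a set \<Rightarrow> 'a ugraph" where
  "induced G X = \<lparr>verts = verts G \<inter> X, edges = {e \<in> edges G. e \<subseteq> X}\<rparr>"

definition del_verts :: "'a ugraph \<Rightarrow> 'a set \<Rightarrow> 'a ugraph" where
  "del_verts G X = induced G (verts G - X)"

definition del_edge :: "'a ugraph \<Rightarrow> 'a set \<Rightarrow> 'a ugraph" where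
  "del_edge G e = \<lparr>verts = verts G, edges = edges G - {e}\<rparr>"

definition component :: "'a ugraph \<Rightarrow> 'a \<Rightarrow> 'a set" where
  "component G v = {w. (adj G)\<^sup>*\<^sup>* v w}"

definition components :: "'a ugraph \<Rightarrow> 'a set set" where
  "components G = component G ` verts G"

definition connected_graph :: "'a ugraph \<Rightarrow> bool" where
  "connected_graph G \<longleftrightarrow> verts G \<noteq> {} \<and> (\<forall>u\<in>verts G. \<forall>v\<in>verts G. (adj G)\<^sup>*\<^sup>* u v)"

definition neighbourhood :: "'a ugraph \<Rightarrow> 'a set \<Rightarrow> 'a set" where
  "neighbourhood G X = {w \<in> verts G - X. \<exists>x\<in>X. adj G x w}"

definition is_cycle :: "'a ugraph \<Rightarrow> 'a list \<Rightarrow> bool" where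
  "is_cycle G xs \<longleftrightarrow> length xs \<ge> 3 \<and> distinct xs \<and>
     (\<forall>i<length xs. adj G (xs ! i) (xs ! (Suc i mod length xs)))"

definition is_tree :: "'a ugraph \<Rightarrow> bool" where
  "is_tree T \<longleftrightarrow> is_graph T \<and> connected_graph T \<and> (\<nexists>xs. is_cycle T xs)"

definition graph_iso :: "'a ugraph \<Rightarrow> 'b ugraph \<Rightarrow> ('a \<Rightarrow> 'b) \<Rightarrow> bool" where
  "graph_iso G H \<phi> \<longleftrightarrow> bij_betw \<phi> (verts G) (verts H) \<and>
     (\<forall>u\<in>verts G. \<forall>v\<in>verts G. adj G u v \<longleftrightarrow> adj H (\<phi> u) (\<phi> v))"


section \<open>Separations and stars\<close>

text \<open>Cardinalities only ever have to be compared with elements of \<open>\<nat> \<union> {\<aleph>\<^sub>0}\<close>, so it suffices to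
  measure them in \<^typ>\<open>enat\<close>, where \<open>\<infinity>\<close> plays the role of \<open>\<aleph>\<^sub>0\<close>: a set has fewer than \<open>\<aleph>\<^sub>0\<close>
  elements iff it is finite.\<close>

definition ecard :: "'a set \<Rightarrow> enat" where
  "ecard X = (if finite X then enat (card X) else \<infinity>)"

text \<open>Oriented separations are pairs \<open>(A, B)\<close>; the unoriented separation is the set \<open>{A, B}\<close>.\<close>

definition oriented_sep :: "'a ugraph \<Rightarrow> 'a set \<times> 'a set \<Rightarrow> bool" where
  "oriented_sep G = (\<lambda>(A, B). A \<union> B = verts G \<and> (\<forall>u\<in>A - B. \<forall>v\<in>B - A. \<not> adj G u v))"

definition oriented_seps :: "enat \<Rightarrow> 'a ugraph \<Rightarrow> ('a set \<times> 'a set) set" where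
  "oriented_seps k G = {(A, B). oriented_sep G (A, B) \<and> ecard (A \<inter> B) < k}"

definition sep_le :: "'a set \<times> 'a set \<Rightarrow> 'a set \<times> 'a set \<Rightarrow> bool" where
  "sep_le = (\<lambda>(A, B) (C, D). A \<subseteq> C \<and> D \<subseteq> B)"

definition has_full_component :: "'a ugraph \<Rightarrow> 'a set \<Rightarrow> 'a set \<Rightarrow> bool" where
  "has_full_component G A B \<longleftrightarrow>
     (\<exists>K\<in>components (del_verts G (A \<inter> B)). K \<subseteq> A - B \<and> neighbourhood G K = A \<inter> B)"

definition tight_sep :: "'a ugraph \<Rightarrow> 'a set set \<Rightarrow> bool" where
  "tight_sep G S \<longleftrightarrow> (\<exists>A B. S = {A, B} \<and> oriented_sep G (A, B) \<and>
     has_full_component G A B \<and> has_full_component G B A)"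

definition is_star :: "'a ugraph \<Rightarrow> ('a set \<times> 'a set) set \<Rightarrow> bool" where
  "is_star G \<sigma> \<longleftrightarrow> \<sigma> \<subseteq> oriented_seps \<infinity> G - {(verts G, verts G)} \<and>
     (\<forall>(A, B)\<in>\<sigma>. \<forall>(C, D)\<in>\<sigma>. (A, B) \<noteq> (C, D) \<longrightarrow> sep_le (A, B) (D, C))"

text \<open>Intersecting with the vertex set only matters for the empty star.\<close>

definition star_interior :: "'a ugraph \<Rightarrow> ('a set \<times> 'a set) set \<Rightarrow> 'a set" where
  "star_interior G \<sigma> = verts G \<inter> (\<Inter>(A, B)\<in>\<sigma>. B)"


section \<open>Blocks\<close>

definition inseparable :: "'a ugraph \<Rightarrow> nat \<Rightarrow> 'a set \<Rightarrow> bool" where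
  "inseparable G k b \<longleftrightarrow> (\<forall>v\<in>b. \<forall>w\<in>b. v \<noteq> w \<longrightarrow>
     (\<nexists>X. X \<subseteq> verts G - {v, w} \<and> ecard X < enat k \<and>
       component (del_verts G X) v \<noteq> component (del_verts G X) w))"

definition is_k_block :: "'a ugraph \<Rightarrow> nat \<Rightarrow> 'a set \<Rightarrow> bool" where
  "is_k_block G k b \<longleftrightarrow> b \<subseteq> verts G \<and> enat k \<le> ecard b \<and> inseparable G k b \<and>
     (\<forall>c. b \<subseteq> c \<and> c \<subseteq> verts G \<and> enat k \<le> ecard c \<and> inseparable G k c \<longrightarrow> c = b)"

definition separable_block :: "'a ugraph \<Rightarrow> 'a set \<Rightarrow> bool" where
  "separable_block G b \<longleftrightarrow> (\<exists>k. is_k_block G k b \<and>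
     (\<exists>\<sigma>. is_star G \<sigma> \<and> \<sigma> \<subseteq> oriented_seps (enat k) G \<and> star_interior G \<sigma> = b))"

definition block_orientation :: "'a ugraph \<Rightarrow> nat \<Rightarrow> 'a set \<Rightarrow> ('a set \<times> 'a set) set" where
  "block_orientation G k b = {(A, B) \<in> oriented_seps (enat k) G. b \<subseteq> B}"


section \<open>Tree-decompositions\<close>

record ('n, 'a) tree_dec =
  tree :: "'n ugraph"
  bag :: "'n \<Rightarrow> 'a set"

definition tree_decomposition :: "'a ugraph \<Rightarrow> ('n, 'a) tree_dec \<Rightarrow> bool" where
  "tree_decomposition G D \<longleftrightarrow> is_tree (tree D) \<and>
     (\<forall>t\<in>verts (tree D). bag D t \<subseteq> verts G) \<and>
     (\<Union>t\<in>verts (tree D). verts (induced G (bag D t))) = verts G \<and>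
     (\<Union>t\<in>verts (tree D). edges (induced G (bag D t))) = edges G \<and>
     (\<forall>v\<in>verts G. connected_graph (induced (tree D) {t. v \<in> bag D t}))"

definition side :: "('n, 'a) tree_dec \<Rightarrow> 'n set \<Rightarrow> 'n \<Rightarrow> 'a set" where
  "side D e t = (\<Union>s\<in>component (del_edge (tree D) e) t. bag D s)"

definition edge_sep :: "('n, 'a) tree_dec \<Rightarrow> 'n set \<Rightarrow> 'a set set" where
  "edge_sep D e = side D e ` e"

definition induced_seps :: "('n, 'a) tree_dec \<Rightarrow> 'a set set set" where
  "induced_seps D = edge_sep D ` edges (tree D)"

definition tight_dec :: "'a ugraph \<Rightarrow> ('n, 'a) tree_dec \<Rightarrow> bool" where
  "tight_dec G D \<longleftrightarrow> (\<forall>S\<in>induced_seps D. tight_sep G S)"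

definition refines :: "('m, 'a) tree_dec \<Rightarrow> ('n, 'a) tree_dec \<Rightarrow> bool" where
  "refines D D' \<longleftrightarrow> induced_seps D' \<subseteq> induced_seps D"

definition distinguishes :: "'a ugraph \<Rightarrow> ('n, 'a) tree_dec \<Rightarrow> 'a set \<Rightarrow> 'a set \<Rightarrow> bool" where
  "distinguishes G D b b' \<longleftrightarrow> (\<exists>k k'. is_k_block G k b \<and> is_k_block G k' b' \<and>
     (\<exists>A B. {A, B} \<in> induced_seps D \<and>
        (A, B) \<in> block_orientation G k b \<and> (B, A) \<in> block_orientation G k' b'))"

text \<open>A block \<open>b\<close> that is contained in no bag of \<open>D\<close>, or in more than one, cannot be the unique bag
  containing \<open>b\<close> in any refinement of \<open>D\<close>. This may happen even for a tight \<open>D\<close>, if \<open>D\<close> uses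
  separations that have too large an order to be oriented by \<open>b\<close>: the vertex set of a path
  \<open>x y z\<close> is a separable 1-block, but it is crossed by the tight separation \<open>{{x, y}, {y, z}}\<close>.\<close>

definition in_unique_bag :: "('n, 'a) tree_dec \<Rightarrow> 'a set \<Rightarrow> bool" where
  "in_unique_bag D b \<longleftrightarrow> (\<exists>!t. t \<in> verts (tree D) \<and> b \<subseteq> bag D t)"


section \<open>Canonicity\<close>

text \<open>Canonicity is a property of an assignment, here considered on an arbitrary class \<open>\<G>\<close> of graphs.\<close>

definition canonical_sets :: "'a ugraph set \<Rightarrow> ('a ugraph \<Rightarrow> 'a set set) \<Rightarrow> bool" where
  "canonical_sets \<G> \<B> \<longleftrightarrow> (\<forall>G\<in>\<G>. \<forall>G'\<in>\<G>. \<forall>\<phi>. graph_iso G G' \<phi> \<longrightarrow>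
     (\<lambda>b. \<phi> ` b) ` \<B> G = \<B> G')"

definition canonical_dec :: "'a ugraph set \<Rightarrow> ('a ugraph \<Rightarrow> ('n, 'a) tree_dec) \<Rightarrow> bool" where
  "canonical_dec \<G> \<Psi> \<longleftrightarrow> (\<forall>G\<in>\<G>. \<forall>G'\<in>\<G>. \<forall>\<phi>. graph_iso G G' \<phi> \<longrightarrow>
     (\<exists>\<alpha>. graph_iso (tree (\<Psi> G)) (tree (\<Psi> G')) \<alpha> \<and>
       (\<forall>t\<in>verts (tree (\<Psi> G)). \<phi> ` bag (\<Psi> G) t = bag (\<Psi> G') (\<alpha> t))))"

end

theory Submission
  imports Defs
begin

text \<open>The proof refines a tree-decomposition by splitting each of its nodes into a star. Fix a subset
  \<open>c t\<close> of every bag \<open>V\<^sub>t\<close>. The centre of the star that replaces \<open>t\<close> gets the bag \<open>c t\<close>, and every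
  component \<open>K\<close> of \<open>G - c t\<close> that meets \<open>V\<^sub>t\<close> contributes a leaf with the bag
  \<open>(K \<union> N(K)) \<inter> V\<^sub>t\<close>. As \<open>N(K) \<subseteq> c t\<close>, these bags cover \<open>V\<^sub>t\<close> and all its edges.

  What has to be found is, for each old tree edge \<open>ts\<close>, a node of the star at \<open>t\<close> whose bag contains the
  whole adhesion set \<open>V\<^sub>t \<inter> V\<^sub>s\<close>. This is where tightness enters. On the side of \<open>s\<close> there is
  a component \<open>J\<close> of \<open>G\<close> minus the separator of \<open>ts\<close> that is disjoint from \<open>V\<^sub>t\<close> and has all
  of \<open>V\<^sub>t \<inter> V\<^sub>s\<close> in its neighbourhood. Being connected and disjoint from \<open>c t\<close>, it lies in a
  single component \<open>K\<close> of \<open>G - c t\<close>, and so \<open>V\<^sub>t \<inter> V\<^sub>s \<subseteq> K \<union> N(K)\<close>. If the adhesion set is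
  contained in \<open>c t\<close>, the edge is attached to the centre, and otherwise to the leaf of this \<open>K\<close>, which
  is then the only component that meets the adhesion set (\<open>port_is_limb\<close>). The old edges keep their
  separations, so that the result is a refinement, for every choice of \<open>c\<close>. No choices are made, and
  hence the construction commutes with isomorphisms (\<open>split_dec_iso\<close>).

  For a set of blocks, let \<open>c t\<close> be the block whose home, the node with the bag around it, is \<open>t\<close> if there is one, and \<open>V\<^sub>t\<close>
  otherwise, in which case \<open>t\<close> is not split. Two distinguished blocks have different homes, because a
  bag that contains both would put one of them inside the separator of the distinguishing edge, which is
  smaller than the block (\<open>distinguished_blocks_not_in_common_bag\<close>). So every block becomes the bag of a
  centre. No leaf bag contains the block again: by separability each component \<open>K\<close> of
  \<open>G - b\<close> has fewer neighbours than the \<open>k\<close>-block \<open>b\<close> has vertices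
  (\<open>separable_block_not_in_neighbourhood\<close>).\<close>


section \<open>Reachability, components and bridges\<close>

lemma adj_commute: "adj G u v \<longleftrightarrow> adj G v u"
  by (simp add: adj_def insert_commute)

lemma adj_in_verts:
  assumes "is_graph G" and "adj G u v"
  shows "u \<in> verts G" and "v \<in> verts G" and "u \<noteq> v"
  using assms by (auto simp: is_graph_def adj_def)

lemma reachable_commute: "(adj G)\<^sup>*\<^sup>* u v \<Longrightarrow> (adj G)\<^sup>*\<^sup>* v u"
  by (rule sympD[OF symp_rtranclp]) (auto intro: sympI simp: adj_commute)

lemma component_self: "v \<in> component G v"
  by (simp add: component_def)

lemma component_step: "u \<in> component G v \<Longrightarrow> adj G u w \<Longrightarrow> w \<in> component G v"
  by (simp add: component_def)

lemma component_eq: "u \<in> component G v \<Longrightarrow> component G u = component G v"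
  unfolding component_def by (auto intro: rtranclp_trans dest: reachable_commute)

lemma component_subset:
  assumes "v \<in> S" and "\<And>u w. u \<in> S \<Longrightarrow> adj G u w \<Longrightarrow> w \<in> S"
  shows "component G v \<subseteq> S"
proof
  fix w assume "w \<in> component G v"
  then have "(adj G)\<^sup>*\<^sup>* v w" by (simp add: component_def)
  then show "w \<in> S" by (induction rule: rtranclp_induct) (use assms in auto)
qed

lemma component_in_verts:
  assumes "is_graph G" and "v \<in> verts G"
  shows "component G v \<subseteq> verts G"
  by (rule component_subset) (use assms adj_in_verts in auto)

lemma adj_del_verts:
  assumes "is_graph G"
  shows "adj (del_verts G X) u v \<longleftrightarrow> adj G u v \<and> u \<notin> X \<and> v \<notin> X"
  using adj_in_verts[OF assms, of u v]
  by (auto simp: adj_def del_verts_def induced_def)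

lemma verts_del_verts: "verts (del_verts G X) = verts G - X"
  by (auto simp: del_verts_def induced_def)

lemma is_graph_induced: "is_graph G \<Longrightarrow> is_graph (induced G X)"
  by (auto simp: is_graph_def induced_def)

lemma is_graph_del_verts: "is_graph G \<Longrightarrow> is_graph (del_verts G X)"
  by (simp add: del_verts_def is_graph_induced)

lemma adj_del_edge: "adj (del_edge G e) u v \<longleftrightarrow> adj G u v \<and> {u, v} \<noteq> e"
  by (simp add: adj_def del_edge_def)

lemma adj_induced: "adj (induced G X) u v \<longleftrightarrow> adj G u v \<and> u \<in> X \<and> v \<in> X"
  by (simp add: adj_def induced_def)

lemma reachable_by_distinct_walk:
  assumes "(adj G)\<^sup>*\<^sup>* u v"
  shows "\<exists>xs. xs \<noteq> [] \<and> distinct xs \<and> hd xs = u \<and> last xs = v \<and> successively (adj G) xs"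
  using assms
proof (induction rule: rtranclp_induct)
  case base
  show ?case by (rule exI[of _ "[u]"]) simp
next
  case (step v w)
  then obtain xs where xs: "xs \<noteq> []" "distinct xs" "hd xs = u" "last xs = v"
    "successively (adj G) xs" by blast
  show ?case
  proof (cases "w \<in> set xs")
    case True
    then obtain ys zs where ys: "xs = (ys @ [w]) @ zs" by (auto simp: in_set_conv_decomp)
    have "successively (adj G) (ys @ [w])"
      using xs(5) unfolding ys successively_append_iff[of _ "ys @ [w]" zs] by blast
    then show ?thesis
      using xs(2,3) ys by (intro exI[of _ "ys @ [w]"]) (cases ys; auto)
  next
    case False
    then show ?thesis
      using xs step.hyps
      by (intro exI[of _ "xs @ [w]"]) (auto simp: successively_append_iff)
  qed
qed

text \<open>A distinct walk that joins the ends of an edge while avoiding it closes up to a cycle.\<close>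

lemma tree_edge_is_bridge:
  assumes "is_tree T" and "adj T u v"
  shows "v \<notin> component (del_edge T {u, v}) u"
proof
  let ?T = "del_edge T {u, v}"
  assume "v \<in> component ?T u"
  then have "(adj ?T)\<^sup>*\<^sup>* u v" by (simp add: component_def)
  then obtain xs where xs: "xs \<noteq> []" "distinct xs" "hd xs = u" "last xs = v"
    "successively (adj ?T) xs" using reachable_by_distinct_walk[of ?T u v] by blast
  have "u \<noteq> v" using adj_in_verts assms by (metis is_tree_def)
  have len: "length xs \<ge> 3"
  proof (rule ccontr)
    assume "\<not> length xs \<ge> 3"
    with xs(1) consider a where "xs = [a]" | a b where "xs = [a, b]"
      by (cases xs; cases "tl xs"; cases "tl (tl xs)") auto
    then show False using xs \<open>u \<noteq> v\<close> by cases (auto simp: adj_del_edge)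
  qed
  have "adj T (xs ! i) (xs ! (Suc i mod length xs))" if i: "i < length xs" for i
  proof (cases "Suc i < length xs")
    case True
    then show ?thesis using successively_nth[OF xs(5), of i] by (simp add: adj_del_edge)
  next
    case False
    with i have "Suc i = length xs" by simp
    then have "i = length xs - 1" and "Suc i mod length xs = 0" by simp_all
    then have "xs ! i = v" using xs(1,4) by (simp add: last_conv_nth)
    with \<open>Suc i mod length xs = 0\<close> show ?thesis
      using assms(2) xs(1,3) by (simp add: hd_conv_nth adj_commute)
  qed
  then have "is_cycle T xs" using len xs(2) by (simp add: is_cycle_def)
  then show False using assms(1) by (auto simp: is_tree_def)
qed

text \<open>Conversely, the rest of a cycle joins the ends of each of its edges. Bridges are easier to
  verify than the absence of cycles: it suffices to exhibit a set that is closed under adjacency once the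
  edge is gone and that contains only one of its ends.\<close>

lemma acyclic_if_edges_are_bridges:
  assumes "\<And>u v. adj T u v \<Longrightarrow> v \<notin> component (del_edge T {u, v}) u"
  shows "\<not> is_cycle T xs"
proof
  assume "is_cycle T xs"
  then have len: "length xs \<ge> 3" and dist: "distinct xs"
    and adj: "\<And>i. i < length xs \<Longrightarrow> adj T (xs ! i) (xs ! (Suc i mod length xs))"
    by (auto simp: is_cycle_def)
  let ?e = "{xs ! 1, xs ! 0}"
  let ?C = "component (del_edge T ?e) (xs ! 1)"
  have nth_eq: "xs ! i = xs ! j \<longleftrightarrow> i = j" if "i < length xs" "j < length xs" for i j
    using that dist by (simp add: nth_eq_iff_index_eq)
  have l: "0 < length xs" "1 < length xs" using len by auto
  have *: "xs ! Suc i \<in> ?C" if "Suc i < length xs" for i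
    using that
  proof (induction i)
    case 0
    then show ?case by (simp add: component_self)
  next
    case (Suc i)
    have "xs ! Suc (Suc i) \<noteq> xs ! 0" "xs ! Suc (Suc i) \<noteq> xs ! 1"
      using nth_eq[OF Suc.prems l(1)] nth_eq[OF Suc.prems l(2)] by simp_all
    then have "{xs ! Suc i, xs ! Suc (Suc i)} \<noteq> ?e" by (auto simp: doubleton_eq_iff)
    moreover have "adj T (xs ! Suc i) (xs ! Suc (Suc i))"
      using adj[of "Suc i"] Suc.prems by simp
    moreover have "xs ! Suc i \<in> ?C" using Suc by simp
    ultimately show ?case
      using component_step[of "xs ! Suc i" "del_edge T ?e"] by (simp add: adj_del_edge)
  qed
  define n where "n = length xs - 1"
  have n: "Suc n = length xs" "n \<ge> 2" using len by (auto simp: n_def)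
  have "Suc (n - 1) = n" using n(2) by simp
  then have "xs ! n \<in> ?C" using *[of "n - 1"] n(1) by simp
  moreover have "{xs ! n, xs ! 0} \<noteq> ?e"
  proof -
    have "n < length xs" using n by linarith
    then have "xs ! n \<noteq> xs ! 0" "xs ! n \<noteq> xs ! 1"
      using nth_eq[OF _ l(1), of n] nth_eq[OF _ l(2), of n] n(2) by simp_all
    then show ?thesis by (auto simp: doubleton_eq_iff)
  qed
  moreover have "adj T (xs ! n) (xs ! 0)" using adj[of n] n(1) by simp
  ultimately have "xs ! 0 \<in> ?C"
    using component_step[of "xs ! n" "del_edge T ?e" "xs ! 1" "xs ! 0"] by (simp add: adj_del_edge)
  moreover have "adj T (xs ! 1) (xs ! 0)"
    using adj[OF l(1)] l(2) adj_commute[of T "xs ! 0" "xs ! 1"] by simp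
  ultimately show False using assms[of "xs ! 1" "xs ! 0"] by simp
qed

lemma connected_del_edge_cover:
  assumes "connected_graph T" and "t \<in> verts T" and "s \<in> verts T"
  shows "s \<in> component (del_edge T {t, t'}) t \<union> component (del_edge T {t, t'}) t'"
proof -
  let ?S = "component (del_edge T {t, t'}) t \<union> component (del_edge T {t, t'}) t'"
  have "component T t \<subseteq> ?S"
  proof (rule component_subset)
    fix u w assume "u \<in> ?S" "adj T u w"
    then show "w \<in> ?S"
      by (cases "{u, w} = {t, t'}")
        (auto simp: doubleton_eq_iff component_self adj_del_edge intro: component_step)
  qed (simp add: component_self)
  then show ?thesis using assms by (auto simp: connected_graph_def component_def)
qed

text \<open>Reachability in a graph whose nodes are pairs, with the nodes of a base graph as first
  components, follows from reachability in the base graph and in each fibre. It is applied to the whole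
  tree, to the tree minus an edge, and to the subtree of the nodes whose bags contain a given
  vertex.\<close>

lemma lift_reachability:
  assumes "R\<^sup>*\<^sup>* s s'" and "(s, X) \<in> N" and "(s', X') \<in> N"
    and fibre: "\<And>s X Y. (s, X) \<in> N \<Longrightarrow> (s, Y) \<in> N \<Longrightarrow> Q\<^sup>*\<^sup>* (s, X) (s, Y)"
    and step: "\<And>s s'. R s s' \<Longrightarrow> \<exists>X Y. (s, X) \<in> N \<and> (s', Y) \<in> N \<and> Q (s, X) (s', Y)"
  shows "Q\<^sup>*\<^sup>* (s, X) (s', X')"
  using assms(1,3)
proof (induction arbitrary: X' rule: rtranclp_induct)
  case base
  then show ?case using fibre assms(2) by blast
next
  case (step u w)
  obtain Y Z where YZ: "(u, Y) \<in> N" "(w, Z) \<in> N" "Q (u, Y) (w, Z)"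
    using assms(5) step.hyps(2) by blast
  have "Q\<^sup>*\<^sup>* (s, X) (w, Z)" using step.IH[OF YZ(1)] YZ(3) by simp
  also have "Q\<^sup>*\<^sup>* (w, Z) (w, X')" using fibre YZ(2) step.prems by blast
  finally show ?case .
qed


section \<open>Splitting the nodes of a tree into stars\<close>

text \<open>Each node \<open>t\<close> becomes a star with centre \<open>(t, {})\<close> and leaves \<open>(t, K)\<close> for \<open>K \<in> L t\<close>,
  and \<open>p t s\<close> tells to which node of the star at \<open>t\<close> the old edge \<open>ts\<close> is attached. The labels are
  sets, since the leaves will be indexed by components, and the empty set is then free to
  mark the centre.\<close>

definition star_tree :: "'n ugraph \<Rightarrow> ('n \<Rightarrow> 'c set set) \<Rightarrow> ('n \<Rightarrow> 'n \<Rightarrow> 'c set) \<Rightarrow> ('n \<times> 'c set) ugraph"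
  where "star_tree T L p = \<lparr>verts = (SIGMA t:verts T. insert {} (L t)),
    edges = {{(t, {}), (t, K)} |t K. t \<in> verts T \<and> K \<in> L t} \<union>
      {{(t, p t s), (s, p s t)} |t s. adj T t s}\<rparr>"

lemma verts_star_tree: "(t, K) \<in> verts (star_tree T L p) \<longleftrightarrow> t \<in> verts T \<and> (K = {} \<or> K \<in> L t)"
  by (auto simp: star_tree_def)

lemma adj_star_tree:
  "adj (star_tree T L p) (t, K) (s, M) \<longleftrightarrow>
    t = s \<and> t \<in> verts T \<and> (K = {} \<and> M \<in> L t \<or> M = {} \<and> K \<in> L t) \<or>
    adj T t s \<and> K = p t s \<and> M = p s t"
  using adj_commute[of T t s]
  by (auto simp: star_tree_def adj_def doubleton_eq_iff)

locale tree_splitting =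
  fixes T :: "'n ugraph" and L :: "'n \<Rightarrow> 'c set set" and p :: "'n \<Rightarrow> 'n \<Rightarrow> 'c set"
  assumes tree: "is_tree T"
    and nonempty: "t \<in> verts T \<Longrightarrow> {} \<notin> L t"
    and port: "adj T t s \<Longrightarrow> p t s = {} \<or> p t s \<in> L t"
begin

abbreviation "T' \<equiv> star_tree T L p"

lemma is_graph_T: "is_graph T"
  using tree by (simp add: is_tree_def)

lemma is_graph_star_tree: "is_graph T'"
  unfolding is_graph_def
proof
  fix e assume "e \<in> edges T'"
  then consider t K where "t \<in> verts T" "K \<in> L t" "e = {(t, {}), (t, K)}"
    | t s where "adj T t s" "e = {(t, p t s), (s, p s t)}"
    by (auto simp: star_tree_def)
  then show "e \<subseteq> verts T' \<and> card e = 2"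
  proof cases
    case 1
    with nonempty have "K \<noteq> {}" by blast
    with 1 show ?thesis by (auto simp: verts_star_tree)
  next
    case 2
    with adj_in_verts[OF is_graph_T 2(1)] port[of t s] port[of s t] adj_commute[of T s t]
    show ?thesis by (auto simp: verts_star_tree)
  qed
qed

lemma fibre_reachable:
  assumes "(s, X) \<in> verts T'" and "(s, Y) \<in> verts T'"
    and spoke: "\<And>K. K \<in> L s \<Longrightarrow> adj H (s, {}) (s, K)"
  shows "(adj H)\<^sup>*\<^sup>* (s, X) (s, Y)"
proof -
  have "(adj H)\<^sup>*\<^sup>* (s, {}) (s, K)" if "(s, K) \<in> verts T'" for K
    using that spoke by (cases "K = {}") (auto simp: verts_star_tree)
  then show ?thesis using assms(1,2) reachable_commute rtranclp_trans by metis
qed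

lemma connected_star_tree: "connected_graph T'"
  unfolding connected_graph_def
proof (intro conjI ballI)
  obtain t where "t \<in> verts T" using tree by (auto simp: is_tree_def connected_graph_def)
  then have "(t, {}) \<in> verts T'" by (simp add: verts_star_tree)
  then show "verts T' \<noteq> {}" by blast
next
  fix x y assume xy: "x \<in> verts T'" "y \<in> verts T'"
  obtain t K s M where eq: "x = (t, K)" "y = (s, M)" by fastforce
  have "(adj T)\<^sup>*\<^sup>* t s"
    using tree xy by (auto simp: eq verts_star_tree is_tree_def connected_graph_def)
  then show "(adj T')\<^sup>*\<^sup>* x y"
    unfolding eq
  proof (rule lift_reachability[where N = "verts T'"])
    show "(adj T')\<^sup>*\<^sup>* (s, X) (s, Y)" if "(s, X) \<in> verts T'" "(s, Y) \<in> verts T'" for s X Y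
      using that by (rule fibre_reachable) (use that in \<open>auto simp: verts_star_tree adj_star_tree\<close>)
  next
    fix s s' assume s: "adj T s s'"
    then show "\<exists>X Y. (s, X) \<in> verts T' \<and> (s', Y) \<in> verts T' \<and> adj T' (s, X) (s', Y)"
      using adj_in_verts[OF is_graph_T s] port[OF s] port[of s' s] adj_commute[of T s s']
      by (intro exI[of _ "p s s'"] exI[of _ "p s' s"]) (auto simp: verts_star_tree adj_star_tree)
  qed (use xy eq in auto)
qed

text \<open>The two sides of an old edge are the full preimages of its two sides in \<open>T\<close>. This yields both
  that the edge remains a bridge and that it still induces the same separation.\<close>

lemma component_del_lifted_edge:
  assumes "adj T t t'"
  shows "component (del_edge T' {(t, p t t'), (t', p t' t)}) (t, p t t') =
    {x \<in> verts T'. fst x \<in> component (del_edge T {t, t'}) t}" (is "component ?H _ = ?S")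
proof
  let ?C = "component (del_edge T {t, t'}) t"
  note tt' = adj_in_verts[OF is_graph_T assms]
  have start: "(t, p t t') \<in> ?S"
    using tt' port[OF assms] by (simp add: component_self verts_star_tree)
  show "component ?H (t, p t t') \<subseteq> ?S"
  proof (rule component_subset[OF start])
    fix x y assume x: "x \<in> ?S" and "adj ?H x y"
    then have xy: "adj T' x y" "{x, y} \<noteq> {(t, p t t'), (t', p t' t)}"
      by (auto simp: adj_del_edge)
    obtain s K r M where eq: "x = (s, K)" "y = (r, M)" by fastforce
    have "r \<in> ?C"
    proof (cases "s = r")
      case False
      with xy have "adj T s r" "K = p s r" "M = p r s" by (auto simp: eq adj_star_tree)
      with xy have "adj (del_edge T {t, t'}) s r"
        by (auto simp: adj_del_edge doubleton_eq_iff eq)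
      with x show ?thesis by (auto simp: eq intro: component_step)
    qed (use x eq in auto)
    then show "y \<in> ?S" using adj_in_verts(2)[OF is_graph_star_tree xy(1)] by (simp add: eq)
  qed
  show "?S \<subseteq> component ?H (t, p t t')"
  proof
    fix x assume x: "x \<in> ?S"
    obtain s K where eq: "x = (s, K)" by fastforce
    have "(adj (del_edge T {t, t'}))\<^sup>*\<^sup>* t s" using x by (simp add: eq component_def)
    then have "(adj ?H)\<^sup>*\<^sup>* (t, p t t') (s, K)"
    proof (rule lift_reachability[where N = "verts T'"])
      show "(adj ?H)\<^sup>*\<^sup>* (s, X) (s, Y)" if "(s, X) \<in> verts T'" "(s, Y) \<in> verts T'" for s X Y
        using that by (rule fibre_reachable)
          (use that tt'(3) in
            \<open>auto simp: verts_star_tree adj_star_tree adj_del_edge doubleton_eq_iff\<close>)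
    next
      fix s s' assume "adj (del_edge T {t, t'}) s s'"
      then have s: "adj T s s'" "{s, s'} \<noteq> {t, t'}" by (auto simp: adj_del_edge)
      then show "\<exists>X Y. (s, X) \<in> verts T' \<and> (s', Y) \<in> verts T' \<and> adj ?H (s, X) (s', Y)"
        using adj_in_verts[OF is_graph_T s(1)] port[OF s(1)] port[of s' s] adj_commute[of T s s']
        by (intro exI[of _ "p s s'"] exI[of _ "p s' s"])
          (auto simp: verts_star_tree adj_star_tree adj_del_edge doubleton_eq_iff)
    qed (use x start eq in auto)
    then show "x \<in> component ?H (t, p t t')" by (simp add: component_def eq)
  qed
qed

lemma spoke_is_bridge:
  assumes t: "t \<in> verts T" and K: "K \<in> L t"
  shows "(t, {}) \<notin> component (del_edge T' {(t, K), (t, {})}) (t, K)"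
proof -
  let ?H = "del_edge T' {(t, K), (t, {})}"
  \<comment> \<open>the side of the leaf: the leaf itself and the branches of \<open>T\<close> that are attached to it\<close>
  define S where "S = {(t, K)} \<union>
    {(s, M) |s M. \<exists>t'. adj T t t' \<and> p t t' = K \<and> s \<in> component (del_edge T {t, t'}) t'}"
  have bridge: "t \<notin> component (del_edge T {t, t'}) t'" if "adj T t t'" for t'
    using tree_edge_is_bridge[OF tree, of t' t] that by (simp add: adj_commute insert_commute)
  have "component ?H (t, K) \<subseteq> S"
  proof (rule component_subset)
    fix x y assume x: "x \<in> S" and "adj ?H x y"
    then have xy: "adj T' x y" "{x, y} \<noteq> {(t, K), (t, {})}"
      by (auto simp: adj_del_edge)
    obtain s M r N where eq: "x = (s, M)" "y = (r, N)" by fastforce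
    show "y \<in> S"
    proof (cases "x = (t, K)")
      case True
      then have "adj T t r" "p t r = K"
        using xy nonempty[OF t] K by (auto simp: eq adj_star_tree insert_commute)
      then show ?thesis by (auto simp: S_def eq component_self)
    next
      case False
      then obtain t' where t': "adj T t t'" "p t t' = K" "s \<in> component (del_edge T {t, t'}) t'"
        using x by (auto simp: S_def eq)
      then have "s \<noteq> t" using bridge by blast
      show ?thesis
      proof (cases "s = r")
        case True
        then show ?thesis using t' by (auto simp: S_def eq)
      next
        case neq: False
        then have sr: "adj T s r" "N = p r s" using xy by (auto simp: eq adj_star_tree)
        show ?thesis
        proof (cases "{s, r} = {t, t'}")
          case True
          then have "r = t" "s = t'" using \<open>s \<noteq> t\<close> by (auto simp: doubleton_eq_iff)
          then show ?thesis using t' sr by (simp add: S_def eq)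
        next
          case False
          then have "adj (del_edge T {t, t'}) s r" using sr by (simp add: adj_del_edge)
          with t'(3) have "r \<in> component (del_edge T {t, t'}) t'" by (rule component_step)
          then show ?thesis using t' by (auto simp: S_def eq)
        qed
      qed
    qed
  qed (simp add: S_def)
  moreover have "(t, {}) \<notin> S" using bridge K nonempty[OF t] by (auto simp: S_def)
  ultimately show ?thesis by blast
qed

lemma is_tree_star_tree: "is_tree T'"
proof -
  have "y \<notin> component (del_edge T' {x, y}) x" if xy: "adj T' x y" for x y
  proof
    assume *: "y \<in> component (del_edge T' {x, y}) x"
    obtain t K s M where eq: "x = (t, K)" "y = (s, M)" by fastforce
    from xy consider "t = s" "t \<in> verts T" "M = {}" "K \<in> L t"
      | "t = s" "t \<in> verts T" "K = {}" "M \<in> L t"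
      | "adj T t s" "K = p t s" "M = p s t"
      by (auto simp: eq adj_star_tree)
    then show False
    proof cases
      case 1
      then show ?thesis using * spoke_is_bridge[of t K] by (simp add: eq)
    next
      case 2
      have "x \<in> component (del_edge T' {x, y}) y"
        using component_eq[OF *] component_self[of x] by blast
      then show ?thesis using 2 spoke_is_bridge[of t M] by (simp add: eq insert_commute)
    next
      case 3
      then show ?thesis
        using * component_del_lifted_edge[OF 3(1)] tree_edge_is_bridge[OF tree 3(1)]
        by (simp add: eq)
    qed
  qed
  then show ?thesis
    using is_graph_star_tree connected_star_tree acyclic_if_edges_are_bridges[of T']
    by (auto simp: is_tree_def)
qed

end


section \<open>Splitting the bags of a tree-decomposition\<close>

text \<open>A component of \<open>G - c t\<close> that misses the bag at \<open>t\<close> would only give a leaf with a bag inside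
  \<open>c t\<close>. With these left out, a node with \<open>c t = bag D t\<close> is not split.\<close>

definition limbs :: "'a ugraph \<Rightarrow> ('n, 'a) tree_dec \<Rightarrow> ('n \<Rightarrow> 'a set) \<Rightarrow> 'n \<Rightarrow> 'a set set" where
  "limbs G D c t = {K \<in> components (del_verts G (c t)). K \<inter> bag D t \<noteq> {}}"

text \<open>For a tight decomposition the union has at most one distinct member (\<open>port_is_limb\<close> below). As a
  union it needs no choice of a component, and it is empty, the label of the centre, exactly
  if \<open>c t\<close> contains the adhesion set.\<close>

definition port :: "'a ugraph \<Rightarrow> ('n, 'a) tree_dec \<Rightarrow> ('n \<Rightarrow> 'a set) \<Rightarrow> 'n \<Rightarrow> 'n \<Rightarrow> 'a set" where
  "port G D c t s = (\<Union>v\<in>bag D t \<inter> bag D s - c t. component (del_verts G (c t)) v)"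

definition split_dec ::
  "'a ugraph \<Rightarrow> ('n, 'a) tree_dec \<Rightarrow> ('n \<Rightarrow> 'a set) \<Rightarrow> ('n \<times> 'a set, 'a) tree_dec" where
  "split_dec G D c = \<lparr>tree = star_tree (tree D) (limbs G D c) (port G D c),
    bag = (\<lambda>(t, K). if K = {} then c t else (K \<union> neighbourhood G K) \<inter> bag D t)\<rparr>"

lemma component_of_deletion:
  assumes "is_graph G" and "K \<in> components (del_verts G X)"
  shows "K \<noteq> {}" and "K \<subseteq> verts G - X" and "neighbourhood G K \<subseteq> X"
    and "v \<in> K \<Longrightarrow> K = component (del_verts G X) v"
proof -
  obtain z where z: "z \<in> verts G - X" "K = component (del_verts G X) z"
    using assms(2) by (auto simp: components_def verts_del_verts)
  show "K \<noteq> {}" using z(2) component_self[of z "del_verts G X"] by auto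
  show K: "K \<subseteq> verts G - X"
    using component_in_verts[OF is_graph_del_verts[OF assms(1)], of z X] z
    by (simp add: verts_del_verts)
  show "neighbourhood G K \<subseteq> X"
  proof (intro subsetI, rule ccontr)
    fix w assume w: "w \<in> neighbourhood G K" "w \<notin> X"
    then obtain x where x: "x \<in> K" "adj G x w" by (auto simp: neighbourhood_def)
    with K w have "adj (del_verts G X) x w" by (auto simp: adj_del_verts[OF assms(1)])
    with x(1) have "w \<in> K" unfolding z(2) by (rule component_step)
    with w show False by (simp add: neighbourhood_def)
  qed
  show "K = component (del_verts G X) v" if "v \<in> K"
    using component_eq[of v "del_verts G X" z] that by (simp add: z(2))
qed

lemma component_in_deletion:
  "v \<in> verts G - X \<Longrightarrow> component (del_verts G X) v \<in> components (del_verts G X)"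
  by (simp add: components_def verts_del_verts)

locale bag_splitting =
  fixes G :: "'a ugraph" and D :: "('n, 'a) tree_dec" and c :: "'n \<Rightarrow> 'a set"
  assumes graph: "is_graph G"
    and dec: "tree_decomposition G D"
    and tight: "tight_dec G D"
    and core: "t \<in> verts (tree D) \<Longrightarrow> c t \<subseteq> bag D t"
begin

abbreviation "T \<equiv> tree D"
abbreviation "D' \<equiv> split_dec G D c"

lemma is_tree_T: "is_tree T" and bag_in_verts: "t \<in> verts T \<Longrightarrow> bag D t \<subseteq> verts G"
  using dec by (auto simp: tree_decomposition_def)

lemma edge_ends: "adj T t s \<Longrightarrow> t \<in> verts T \<and> s \<in> verts T"
  using is_tree_T adj_in_verts by (metis is_tree_def)

text \<open>The component is the one that tightness provides on the side of \<open>s\<close>. Its neighbourhood is the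
  separator of the edge, and this contains the adhesion set because each of the two bags lies on its
  own side.\<close>

lemma far_component:
  assumes "adj T t s"
  obtains J X where "J \<in> components (del_verts G X)" and "J \<inter> bag D t = {}"
    and "bag D t \<inter> bag D s \<subseteq> neighbourhood G J"
proof -
  let ?e = "{t, s}"
  have "edge_sep D ?e \<in> induced_seps D" using assms by (simp add: induced_seps_def adj_def)
  with tight obtain A B where AB: "edge_sep D ?e = {A, B}"
    "has_full_component G A B" "has_full_component G B A"
    unfolding tight_dec_def tight_sep_def by metis
  have "has_full_component G (side D ?e s) (side D ?e t)"
    using AB by (auto simp: edge_sep_def doubleton_eq_iff)
  then obtain J where J: "J \<in> components (del_verts G (side D ?e s \<inter> side D ?e t))"
    "J \<subseteq> side D ?e s - side D ?e t" "neighbourhood G J = side D ?e s \<inter> side D ?e t"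
    by (auto simp: has_full_component_def)
  have "bag D t \<subseteq> side D ?e t" "bag D s \<subseteq> side D ?e s"
    using component_self by (fastforce simp: side_def)+
  with J show ?thesis using that[of J] by blast
qed

text \<open>The far component \<open>J\<close> is connected and avoids \<open>c t\<close>, so that it lies in one component of
  \<open>G - c t\<close>. Each vertex of the adhesion set has a neighbour in \<open>J\<close>, and therefore belongs to the
  component or to its neighbourhood.\<close>

lemma port_is_limb:
  assumes "adj T t s" and v: "v \<in> bag D t \<inter> bag D s - c t"
  shows "port G D c t s = component (del_verts G (c t)) v"
    and "port G D c t s \<in> limbs G D c t"
    and "bag D t \<inter> bag D s \<subseteq> port G D c t s \<union> neighbourhood G (port G D c t s)"
proof -
  let ?H = "del_verts G (c t)"
  have t: "t \<in> verts T" using edge_ends assms(1) by blast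
  obtain J X where J: "J \<in> components (del_verts G X)" "J \<inter> bag D t = {}"
    "bag D t \<inter> bag D s \<subseteq> neighbourhood G J"
    using far_component[OF assms(1)] by blast
  then obtain z where z: "J = component (del_verts G X) z" by (auto simp: components_def)
  define K where "K = component ?H z"
  have Jc: "J \<inter> c t = {}" using J(2) core[OF t] by blast
  \<comment> \<open>walking inside \<open>J\<close> never meets \<open>c t\<close>, so it does not leave \<open>K\<close>\<close>
  have "J \<subseteq> J \<inter> K"
  proof (subst (1) z, rule component_subset)
    show "z \<in> J \<inter> K" by (simp add: z K_def component_self)
    fix u w assume u: "u \<in> J \<inter> K" and uw: "adj (del_verts G X) u w"
    then have "w \<in> J" unfolding z by (blast intro: component_step)
    moreover have "adj ?H u w"
      using u uw \<open>w \<in> J\<close> Jc by (auto simp: adj_del_verts[OF graph])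
    then have "w \<in> K" using u unfolding K_def by (blast intro: component_step)
    ultimately show "w \<in> J \<inter> K" by blast
  qed
  then have JK: "J \<subseteq> K" by blast
  have inK: "w \<in> K" if w: "w \<in> bag D t \<inter> bag D s - c t" for w
  proof -
    obtain x where "x \<in> J" "adj G x w" using w J(3) by (auto simp: neighbourhood_def)
    then have "adj ?H x w" using w Jc by (auto simp: adj_del_verts[OF graph])
    then show ?thesis using \<open>x \<in> J\<close> JK unfolding K_def by (blast intro: component_step)
  qed
  then have comp: "component ?H w = K" if "w \<in> bag D t \<inter> bag D s - c t" for w
    using that component_eq unfolding K_def by metis
  show port: "port G D c t s = component ?H v"
    using comp v unfolding port_def by auto
  have v': "v \<in> verts G - c t" using v bag_in_verts[OF t] by blast
  have lim: "K \<in> components ?H" using component_in_deletion[OF v'] comp[OF v] by simp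
  then show "port G D c t s \<in> limbs G D c t"
    using v inK[OF v] port comp[OF v] by (auto simp: limbs_def)
  have "w \<in> K \<union> neighbourhood G K" if w: "w \<in> bag D t \<inter> bag D s" for w
  proof (cases "w \<in> c t")
    case True
    obtain x where "x \<in> J" "adj G x w" using w J(3) by (auto simp: neighbourhood_def)
    moreover have "w \<notin> K" using component_of_deletion(2)[OF graph lim] True by blast
    ultimately show ?thesis
      using JK adj_in_verts(2)[OF graph] by (auto simp: neighbourhood_def)
  qed (use w inK in blast)
  then show "bag D t \<inter> bag D s \<subseteq> port G D c t s \<union> neighbourhood G (port G D c t s)"
    using port comp[OF v] by auto
qed

sublocale tree_splitting T "limbs G D c" "port G D c"
proof
  show "is_tree T" by (rule is_tree_T)
  show "{} \<notin> limbs G D c t" for t by (auto simp: limbs_def)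
  show "port G D c t s = {} \<or> port G D c t s \<in> limbs G D c t" if "adj T t s" for t s
  proof (cases "bag D t \<inter> bag D s - c t = {}")
    case True
    show ?thesis unfolding port_def True by simp
  next
    case False
    then show ?thesis using port_is_limb(2)[OF that] by blast
  qed
qed

lemma tree_split_dec: "tree D' = T'"
  by (simp add: split_dec_def)

lemma bag_split_dec:
  "bag D' (t, K) = (if K = {} then c t else (K \<union> neighbourhood G K) \<inter> bag D t)"
  by (simp add: split_dec_def)

lemma bag_split_subset: "x \<in> verts T' \<Longrightarrow> bag D' x \<subseteq> bag D (fst x)"
  using core by (cases x) (auto simp: bag_split_dec verts_star_tree)

text \<open>A vertex of the bag at \<open>t\<close> outside \<open>c t\<close> occurs in exactly one node of the star at \<open>t\<close>,
  the leaf of its component, because the neighbourhood of every component lies in \<open>c t\<close>.\<close>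

lemma limb_at:
  assumes "t \<in> verts T" and "v \<in> bag D t - c t"
  shows "component (del_verts G (c t)) v \<in> limbs G D c t"
    and "(t, K) \<in> verts T' \<Longrightarrow> v \<in> bag D' (t, K) \<Longrightarrow> K = component (del_verts G (c t)) v"
proof -
  let ?H = "del_verts G (c t)"
  have "v \<in> verts G - c t" using assms bag_in_verts by blast
  from component_in_deletion[OF this] show "component ?H v \<in> limbs G D c t"
    using assms(2) component_self[of v ?H] by (auto simp: limbs_def)
next
  let ?H = "del_verts G (c t)"
  assume K: "(t, K) \<in> verts T'" "v \<in> bag D' (t, K)"
  have "K \<noteq> {}" using K(2) assms(2) by (auto simp: bag_split_dec)
  then have comp: "K \<in> components ?H" using K(1) by (simp add: verts_star_tree limbs_def)
  have "v \<in> K \<union> neighbourhood G K" using K(2) \<open>K \<noteq> {}\<close> by (simp add: bag_split_dec)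
  then have "v \<in> K" using component_of_deletion(3)[OF graph comp] assms(2) by blast
  then show "K = component ?H v" by (rule component_of_deletion(4)[OF graph comp])
qed

text \<open>An edge with an end outside \<open>c t\<close> lies within the component of that end and its
  neighbourhood, and all other edges lie within \<open>c t\<close>. Allowing \<open>u = v\<close> covers single vertices as
  well.\<close>

lemma edge_in_split_bag:
  assumes t: "t \<in> verts T" and "u \<in> bag D t" "v \<in> bag D t" and "u = v \<or> adj G u v"
  shows "\<exists>K. (t, K) \<in> verts T' \<and> {u, v} \<subseteq> bag D' (t, K)"
proof -
  have *: "\<exists>K. (t, K) \<in> verts T' \<and> {x, y} \<subseteq> bag D' (t, K)"
    if xy: "x \<in> bag D t - c t" "y \<in> bag D t" "x = y \<or> adj G x y" for x y
  proof -
    let ?K = "component (del_verts G (c t)) x"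
    have "x \<in> ?K" by (rule component_self)
    moreover have "y \<in> verts G" using xy(2) bag_in_verts[OF t] by blast
    ultimately have "y \<in> ?K \<union> neighbourhood G ?K"
      using xy(3) by (auto simp: neighbourhood_def)
    then have "{x, y} \<subseteq> bag D' (t, ?K)" using xy \<open>x \<in> ?K\<close> by (auto simp: bag_split_dec)
    then show ?thesis
      using limb_at(1)[OF t xy(1)] t by (intro exI[of _ ?K]) (simp add: verts_star_tree)
  qed
  consider "u \<notin> c t" | "v \<notin> c t" | "u \<in> c t" "v \<in> c t" by blast
  then show ?thesis
  proof cases
    case 1
    then show ?thesis using * assms by blast
  next
    case 2
    then show ?thesis using *[of v u] assms by (auto simp: adj_commute)
  next
    case 3
    then show ?thesis
      using t by (intro exI[of _ "{}"]) (simp add: verts_star_tree bag_split_dec)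
  qed
qed

lemma split_bags_cover:
  assumes "C \<subseteq> verts T"
  shows "(\<Union>x\<in>{x \<in> verts T'. fst x \<in> C}. bag D' x) = (\<Union>t\<in>C. bag D t)"
proof
  show "(\<Union>x\<in>{x \<in> verts T'. fst x \<in> C}. bag D' x) \<subseteq> (\<Union>t\<in>C. bag D t)"
    using bag_split_subset by blast
  show "(\<Union>t\<in>C. bag D t) \<subseteq> (\<Union>x\<in>{x \<in> verts T'. fst x \<in> C}. bag D' x)"
  proof
    fix v assume "v \<in> (\<Union>t\<in>C. bag D t)"
    then obtain t where t: "t \<in> C" "v \<in> bag D t" by blast
    then obtain K where "(t, K) \<in> verts T'" "v \<in> bag D' (t, K)"
      using edge_in_split_bag[of t v v] assms by auto
    with t show "v \<in> (\<Union>x\<in>{x \<in> verts T'. fst x \<in> C}. bag D' x)" by force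
  qed
qed

lemma adhesion_in_port_bag:
  assumes "adj T t s"
  shows "bag D t \<inter> bag D s \<subseteq> bag D' (t, port G D c t s)"
proof (cases "bag D t \<inter> bag D s - c t = {}")
  case True
  have "port G D c t s = {}" unfolding port_def True by simp
  with True show ?thesis by (auto simp: bag_split_dec)
next
  case False
  then obtain v where v: "v \<in> bag D t \<inter> bag D s - c t" by blast
  then have "port G D c t s \<noteq> {}" using port_is_limb(2)[OF assms v] by (auto simp: limbs_def)
  with port_is_limb(3)[OF assms v] show ?thesis by (simp add: bag_split_dec)
qed

text \<open>In the star at \<open>s\<close>, the nodes that contain \<open>v\<close> are the centre and some of the leaves if
  \<open>v \<in> c s\<close>, and a single leaf otherwise. Neighbouring stars are joined by an edge whose two bags contain
  the adhesion set.\<close>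

lemma connected_support:
  assumes "v \<in> verts G"
  shows "connected_graph (induced T' {x. v \<in> bag D' x})"
proof -
  let ?R = "induced T {t. v \<in> bag D t}" and ?Q = "induced T' {x. v \<in> bag D' x}"
  have R: "connected_graph ?R" using dec assms by (auto simp: tree_decomposition_def)
  then obtain t where "t \<in> verts T" "v \<in> bag D t"
    by (auto simp: connected_graph_def induced_def)
  then obtain K where "(t, K) \<in> verts T'" "v \<in> bag D' (t, K)"
    using edge_in_split_bag[of t v v] by auto
  then have "verts ?Q \<noteq> {}" by (auto simp: induced_def)
  moreover have "(adj ?Q)\<^sup>*\<^sup>* x y" if xy: "x \<in> verts ?Q" "y \<in> verts ?Q" for x y
  proof -
    obtain t K s M where eq: "x = (t, K)" "y = (s, M)" by fastforce
    have "(adj ?R)\<^sup>*\<^sup>* t s"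
      using R xy bag_split_subset[of x] bag_split_subset[of y]
      by (auto simp: connected_graph_def induced_def eq verts_star_tree)
    then show ?thesis
      unfolding eq
    proof (rule lift_reachability[where N = "verts ?Q"])
      fix s X Y assume XY: "(s, X) \<in> verts ?Q" "(s, Y) \<in> verts ?Q"
      then have s: "(s, X) \<in> verts T'" "v \<in> bag D' (s, X)" "(s, Y) \<in> verts T'"
        "v \<in> bag D' (s, Y)" "s \<in> verts T" by (auto simp: induced_def verts_star_tree)
      show "(adj ?Q)\<^sup>*\<^sup>* (s, X) (s, Y)"
      proof (cases "v \<in> c s")
        case True
        have "(adj ?Q)\<^sup>*\<^sup>* (s, {}) (s, Z)" if "(s, Z) \<in> verts ?Q" for Z
        proof (cases "Z = {}")
          case False
          with that have "Z \<in> limbs G D c s" "v \<in> bag D' (s, Z)"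
            by (auto simp: induced_def verts_star_tree)
          then have "adj ?Q (s, {}) (s, Z)"
            using True s by (simp add: adj_induced adj_star_tree bag_split_dec)
          then show ?thesis by simp
        qed simp
        from reachable_commute[OF this[OF XY(1)]] this[OF XY(2)]
        show ?thesis by (rule rtranclp_trans)
      next
        case False
        moreover have "v \<in> bag D s" using bag_split_subset[OF s(1)] s(2) by auto
        ultimately have "X = Y" using limb_at(2)[of s v] s by blast
        then show ?thesis by simp
      qed
    next
      fix s s' assume "adj ?R s s'"
      then have s: "adj T s s'" "adj T s' s" "v \<in> bag D s" "v \<in> bag D s'"
        using adj_commute[of T s s'] by (simp_all add: adj_induced)
      then have *: "adj ?Q (s, port G D c s s') (s', port G D c s' s)"
        using adhesion_in_port_bag[OF s(1)] adhesion_in_port_bag[OF s(2)]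
        by (auto simp: adj_induced adj_star_tree)
      moreover have "(s, port G D c s s') \<in> verts ?Q \<and> (s', port G D c s' s) \<in> verts ?Q"
        using adj_in_verts(1,2)[OF is_graph_induced[OF is_graph_star_tree] *] by simp
      ultimately show "\<exists>X Y. (s, X) \<in> verts ?Q \<and> (s', Y) \<in> verts ?Q \<and> adj ?Q (s, X) (s', Y)"
        by blast
    qed (use xy eq in auto)
  qed
  ultimately show ?thesis by (simp add: connected_graph_def)
qed

lemma tree_decomposition_split_dec: "tree_decomposition G D'"
  unfolding tree_decomposition_def tree_split_dec
proof (intro conjI ballI)
  show "is_tree T'" by (rule is_tree_star_tree)
  show in_verts: "bag D' x \<subseteq> verts G" if "x \<in> verts T'" for x
    using bag_split_subset[OF that] bag_in_verts that by (cases x) (force simp: verts_star_tree)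
  have "(\<Union>x\<in>verts T'. bag D' x) = verts G"
  proof -
    have "(\<Union>x\<in>verts T'. bag D' x) = (\<Union>x\<in>{x \<in> verts T'. fst x \<in> verts T}. bag D' x)"
      by (auto simp: verts_star_tree)
    also have "\<dots> = (\<Union>t\<in>verts T. bag D t)" by (rule split_bags_cover) simp
    also have "\<dots> = verts G" using dec by (fastforce simp: tree_decomposition_def induced_def)
    finally show ?thesis .
  qed
  then show "(\<Union>x\<in>verts T'. verts (induced G (bag D' x))) = verts G"
    by (auto simp: induced_def)
  show "(\<Union>x\<in>verts T'. edges (induced G (bag D' x))) = edges G"
  proof
    show "edges G \<subseteq> (\<Union>x\<in>verts T'. edges (induced G (bag D' x)))"
    proof
      fix e assume e: "e \<in> edges G"
      also have "edges G = (\<Union>t\<in>verts T. edges (induced G (bag D t)))"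
        using dec by (simp add: tree_decomposition_def)
      finally obtain t where t: "t \<in> verts T" "e \<subseteq> bag D t" by (auto simp: induced_def)
      obtain u v where uv: "e = {u, v}"
        using e graph by (auto simp: is_graph_def card_2_iff)
      obtain K where "(t, K) \<in> verts T'" "e \<subseteq> bag D' (t, K)"
        using edge_in_split_bag[of t u v] t e by (auto simp: uv adj_def)
      with e show "e \<in> (\<Union>x\<in>verts T'. edges (induced G (bag D' x)))"
        by (force simp: induced_def)
    qed
  qed (auto simp: induced_def)
qed (rule connected_support)

lemma refines_split_dec: "refines D' D"
  unfolding refines_def
proof
  fix S assume "S \<in> induced_seps D"
  then obtain e where e: "e \<in> edges T" "S = edge_sep D e" by (auto simp: induced_seps_def)
  then obtain t s where ts: "e = {t, s}"
    using is_tree_T by (auto simp: is_tree_def is_graph_def card_2_iff)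
  let ?p = "port G D c"
  let ?e = "{(t, ?p t s), (s, ?p s t)}"
  have lift: "side D' {(t, ?p t s), (s, ?p s t)} (t, ?p t s) = side D {t, s} t"
    if a: "adj T t s" for t s
  proof -
    have "component (del_edge T {t, s}) t \<subseteq> verts T"
      using component_in_verts[of "del_edge T {t, s}" t] edge_ends[OF a] is_tree_T
      by (auto simp: is_tree_def is_graph_def del_edge_def)
    then show ?thesis
      unfolding side_def tree_split_dec component_del_lifted_edge[OF a]
      by (rule split_bags_cover)
  qed
  have a: "adj T t s" "adj T s t" using e ts by (auto simp: adj_def insert_commute)
  have "edge_sep D' ?e = S"
    using lift[OF a(1)] lift[OF a(2)] by (simp add: e ts edge_sep_def insert_commute)
  moreover have "adj T' (t, ?p t s) (s, ?p s t)" using a(1) by (simp add: adj_star_tree)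
  then have "?e \<in> edges (tree D')" by (simp add: tree_split_dec adj_def)
  ultimately show "S \<in> induced_seps D'" by (auto simp: induced_seps_def)
qed

end


section \<open>Isomorphisms\<close>

lemma graph_iso_component:
  assumes "is_graph G" and "is_graph G'" and iso: "graph_iso G G' \<phi>" and v: "v \<in> verts G"
  shows "\<phi> ` component G v = component G' (\<phi> v)"
proof
  have bij: "bij_betw \<phi> (verts G) (verts G')"
    and adj: "\<And>x y. x \<in> verts G \<Longrightarrow> y \<in> verts G \<Longrightarrow> adj G x y \<longleftrightarrow> adj G' (\<phi> x) (\<phi> y)"
    using iso by (auto simp: graph_iso_def)
  have "component G v \<subseteq> {u \<in> verts G. \<phi> u \<in> component G' (\<phi> v)}"
  proof (rule component_subset)
    fix u w assume u: "u \<in> {u \<in> verts G. \<phi> u \<in> component G' (\<phi> v)}" and uw: "adj G u w"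
    have "w \<in> verts G" using uw adj_in_verts assms(1) by metis
    with u uw adj[of u w] show "w \<in> {u \<in> verts G. \<phi> u \<in> component G' (\<phi> v)}"
      by (auto intro: component_step)
  qed (simp add: v component_self)
  then show "\<phi> ` component G v \<subseteq> component G' (\<phi> v)" by blast
  show "component G' (\<phi> v) \<subseteq> \<phi> ` component G v"
  proof (rule component_subset)
    fix u w assume "u \<in> \<phi> ` component G v" and uw: "adj G' u w"
    then obtain x where x: "x \<in> component G v" "u = \<phi> x" by blast
    have "w \<in> verts G'" using uw adj_in_verts assms(2) by metis
    then obtain y where y: "y \<in> verts G" "w = \<phi> y" using bij by (auto simp: bij_betw_def)
    have "x \<in> verts G" using x component_in_verts[OF assms(1) v] by blast
    then have "adj G x y" using adj[of x y] uw x y by simp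
    then show "w \<in> \<phi> ` component G v" using x y by (auto intro: component_step)
  qed (simp add: component_self)
qed

lemma graph_iso_del_verts:
  assumes "is_graph G" and "is_graph G'" and iso: "graph_iso G G' \<phi>" and X: "X \<subseteq> verts G"
  shows "graph_iso (del_verts G X) (del_verts G' (\<phi> ` X)) \<phi>"
proof -
  have inj: "inj_on \<phi> (verts G)" and im: "\<phi> ` verts G = verts G'"
    using iso by (auto simp: graph_iso_def bij_betw_def)
  have mem: "\<phi> x \<in> \<phi> ` X \<longleftrightarrow> x \<in> X" if "x \<in> verts G" for x
    using inj_on_image_mem_iff[OF inj that X] .
  have "bij_betw \<phi> (verts G - X) (verts G' - \<phi> ` X)"
    unfolding bij_betw_def im[symmetric] using inj X mem by (auto intro: inj_on_diff)
  then show ?thesis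
    using iso mem
    by (auto simp: graph_iso_def verts_del_verts adj_del_verts[OF assms(1)]
        adj_del_verts[OF assms(2)])
qed

lemma graph_iso_neighbourhood:
  assumes iso: "graph_iso G G' \<phi>" and K: "K \<subseteq> verts G"
  shows "\<phi> ` neighbourhood G K = neighbourhood G' (\<phi> ` K)"
proof -
  have inj: "inj_on \<phi> (verts G)" and im: "\<phi> ` verts G = verts G'"
    and adj: "\<And>x y. x \<in> verts G \<Longrightarrow> y \<in> verts G \<Longrightarrow> adj G x y \<longleftrightarrow> adj G' (\<phi> x) (\<phi> y)"
    using iso by (auto simp: graph_iso_def bij_betw_def)
  have mem: "\<phi> x \<in> \<phi> ` K \<longleftrightarrow> x \<in> K" if "x \<in> verts G" for x
    using inj_on_image_mem_iff[OF inj that K] .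
  have "\<phi> x \<in> neighbourhood G' (\<phi> ` K) \<longleftrightarrow> x \<in> neighbourhood G K" if "x \<in> verts G" for x
    using that mem[OF that] adj K im by (auto simp: neighbourhood_def)
  moreover have "neighbourhood G' (\<phi> ` K) \<subseteq> \<phi> ` verts G" "neighbourhood G K \<subseteq> verts G"
    by (auto simp: neighbourhood_def im)
  ultimately show ?thesis by blast
qed

text \<open>Taking images under \<open>\<phi>\<close> is injective only on sets of vertices, whence the family \<open>\<U>\<close> that
  contains all the labels in play.\<close>

lemma graph_iso_star_tree:
  assumes alpha: "graph_iso T T' \<alpha>"
    and inj: "inj_on ((`) \<phi>) \<U>"
    and U: "{} \<in> \<U>" "\<And>t. t \<in> verts T \<Longrightarrow> L t \<subseteq> \<U>" "\<And>t s. adj T t s \<Longrightarrow> p t s \<in> \<U>"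
    and T: "is_graph T"
    and L: "\<And>t. t \<in> verts T \<Longrightarrow> L' (\<alpha> t) = (`) \<phi> ` L t"
    and p: "\<And>t s. adj T t s \<Longrightarrow> p' (\<alpha> t) (\<alpha> s) = \<phi> ` p t s"
  shows "graph_iso (star_tree T L p) (star_tree T' L' p') (\<lambda>(t, K). (\<alpha> t, \<phi> ` K))"
proof -
  let ?f = "\<lambda>(t, K). (\<alpha> t, \<phi> ` K)"
  have inj_a: "inj_on \<alpha> (verts T)" and im_a: "\<alpha> ` verts T = verts T'"
    and adj: "\<And>x y. x \<in> verts T \<Longrightarrow> y \<in> verts T \<Longrightarrow> adj T x y \<longleftrightarrow> adj T' (\<alpha> x) (\<alpha> y)"
    using alpha by (auto simp: graph_iso_def bij_betw_def)
  have node: "t \<in> verts T" "K \<in> \<U>" if "(t, K) \<in> verts (star_tree T L p)" for t K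
    using that U by (auto simp: verts_star_tree)
  have img: "\<phi> ` K = \<phi> ` M \<longleftrightarrow> K = M" if "K \<in> \<U>" "M \<in> \<U>" for K M
    using inj that by (auto simp: inj_on_def)
  have limb: "\<phi> ` K \<in> L' (\<alpha> t) \<longleftrightarrow> K \<in> L t" if "t \<in> verts T" "K \<in> \<U>" for t K
    using inj_on_image_mem_iff[OF inj that(2) U(2)[OF that(1)]] L[OF that(1)] by simp
  have "inj_on ?f (verts (star_tree T L p))"
    using inj_a img node by (auto simp: inj_on_def)
  moreover have "?f ` verts (star_tree T L p) = verts (star_tree T' L' p')"
  proof
    show "?f ` verts (star_tree T L p) \<subseteq> verts (star_tree T' L' p')"
      using L by (auto simp: verts_star_tree im_a[symmetric])
    show "verts (star_tree T' L' p') \<subseteq> ?f ` verts (star_tree T L p)"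
    proof
      fix y assume y: "y \<in> verts (star_tree T' L' p')"
      obtain t' M where eq: "y = (t', M)" by fastforce
      obtain t where t: "t \<in> verts T" "t' = \<alpha> t" using y im_a by (auto simp: eq verts_star_tree)
      obtain K where "K = {} \<or> K \<in> L t" "M = \<phi> ` K"
        using y L[OF t(1)] by (auto simp: eq t verts_star_tree)
      then show "y \<in> ?f ` verts (star_tree T L p)"
        using t by (intro image_eqI[of _ _ "(t, K)"]) (auto simp: eq verts_star_tree)
    qed
  qed
  moreover have "adj (star_tree T L p) (t, K) (s, M) \<longleftrightarrow>
      adj (star_tree T' L' p') (\<alpha> t, \<phi> ` K) (\<alpha> s, \<phi> ` M)"
    if "(t, K) \<in> verts (star_tree T L p)" "(s, M) \<in> verts (star_tree T L p)" for t K s M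
  proof -
    note n = node[OF that(1)] node[OF that(2)]
    have "\<alpha> t = \<alpha> s \<longleftrightarrow> t = s" "\<alpha> t \<in> verts T'"
      using inj_a im_a n by (auto simp: inj_on_def)
    then have spokes: "\<alpha> t = \<alpha> s \<and> \<alpha> t \<in> verts T' \<and>
        (\<phi> ` K = {} \<and> \<phi> ` M \<in> L' (\<alpha> t) \<or> \<phi> ` M = {} \<and> \<phi> ` K \<in> L' (\<alpha> t)) \<longleftrightarrow>
      t = s \<and> t \<in> verts T \<and> (K = {} \<and> M \<in> L t \<or> M = {} \<and> K \<in> L t)"
      using limb[OF n(1,2)] limb[OF n(1,4)] n(1) by simp
    have lifted: "adj T' (\<alpha> t) (\<alpha> s) \<and> \<phi> ` K = p' (\<alpha> t) (\<alpha> s) \<and> \<phi> ` M = p' (\<alpha> s) (\<alpha> t) \<longleftrightarrow>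
      adj T t s \<and> K = p t s \<and> M = p s t"
    proof (cases "adj T t s")
      case True
      then have ts: "adj T s t" by (simp add: adj_commute)
      show ?thesis
        using True adj[OF n(1,3)] img[OF n(2) U(3)[OF True]] img[OF n(4) U(3)[OF ts]]
        by (simp only: p[OF True] p[OF ts])
    qed (use adj[OF n(1,3)] in simp)
    show ?thesis by (simp only: adj_star_tree spokes lifted)
  qed
  ultimately show ?thesis by (auto simp: graph_iso_def bij_betw_def)
qed

lemma split_dec_iso:
  assumes split: "bag_splitting G D c" "bag_splitting G' D' c'"
    and iso: "graph_iso G G' \<phi>" and alpha: "graph_iso (tree D) (tree D') \<alpha>"
    and bags: "\<And>t. t \<in> verts (tree D) \<Longrightarrow> bag D' (\<alpha> t) = \<phi> ` bag D t"
    and cores: "\<And>t. t \<in> verts (tree D) \<Longrightarrow> c' (\<alpha> t) = \<phi> ` c t"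
  shows "\<exists>\<beta>. graph_iso (tree (split_dec G D c)) (tree (split_dec G' D' c')) \<beta> \<and>
    (\<forall>x\<in>verts (tree (split_dec G D c)).
      \<phi> ` bag (split_dec G D c) x = bag (split_dec G' D' c') (\<beta> x))"
proof -
  interpret A: bag_splitting G D c by fact
  interpret B: bag_splitting G' D' c' by fact
  let ?\<beta> = "\<lambda>(t, K). (\<alpha> t, \<phi> ` K)"
  have inj: "inj_on \<phi> (verts G)" using iso by (auto simp: graph_iso_def bij_betw_def)
  have core_in: "c t \<subseteq> verts G" if "t \<in> verts A.T" for t
    using A.core A.bag_in_verts that by blast
  have comp: "\<phi> ` component (del_verts G (c t)) v = component (del_verts G' (c' (\<alpha> t))) (\<phi> v)"
    if "t \<in> verts A.T" "v \<in> verts G - c t" for t v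
    using graph_iso_component[OF is_graph_del_verts is_graph_del_verts
        graph_iso_del_verts[OF A.graph B.graph iso core_in]] that A.graph B.graph cores
    by (simp add: verts_del_verts)
  have mem: "\<phi> ` X \<inter> \<phi> ` Y = \<phi> ` (X \<inter> Y)" "\<phi> ` X - \<phi> ` Y = \<phi> ` (X - Y)"
    if "X \<subseteq> verts G" "Y \<subseteq> verts G" for X Y
    using inj_on_image_Int[OF inj that] inj_on_image_set_diff[OF inj, of X Y] that by auto
  have limb_in: "K \<subseteq> verts G" if "K \<in> limbs G D c t" for K t
    using that component_of_deletion(2)[OF A.graph] by (fastforce simp: limbs_def)
  have limbs: "limbs G' D' c' (\<alpha> t) = (`) \<phi> ` limbs G D c t" if t: "t \<in> verts A.T" for t
  proof -
    have "verts G' - \<phi> ` c t = \<phi> ` (verts G - c t)"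
      using mem(2)[of "verts G" "c t"] core_in[OF t] iso by (auto simp: graph_iso_def bij_betw_def)
    then have comps: "components (del_verts G' (c' (\<alpha> t))) = (`) \<phi> ` components (del_verts G (c t))"
      using comp[OF t] cores[OF t] by (auto simp: components_def verts_del_verts image_image)
    have "\<phi> ` K \<inter> bag D' (\<alpha> t) = \<phi> ` (K \<inter> bag D t)" if "K \<in> components (del_verts G (c t))" for K
      using component_of_deletion(2)[OF A.graph that] mem(1)[of K "bag D t"] bags[OF t]
        A.bag_in_verts[OF t] by auto
    then show ?thesis unfolding limbs_def comps by auto
  qed
  have ports: "port G' D' c' (\<alpha> t) (\<alpha> s) = \<phi> ` port G D c t s" if "adj A.T t s" for t s
  proof -
    have ts: "t \<in> verts A.T" "s \<in> verts A.T" using A.edge_ends that by auto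
    note sub = A.bag_in_verts[OF ts(1)] A.bag_in_verts[OF ts(2)] core_in[OF ts(1)]
    have "bag D' (\<alpha> t) \<inter> bag D' (\<alpha> s) - c' (\<alpha> t) = \<phi> ` (bag D t \<inter> bag D s - c t)"
      using mem(1)[OF sub(1,2)] mem(2)[of "bag D t \<inter> bag D s" "c t"] sub bags cores ts by auto
    moreover have "component (del_verts G' (c' (\<alpha> t))) (\<phi> v) =
        \<phi> ` component (del_verts G (c t)) v" if "v \<in> bag D t \<inter> bag D s - c t" for v
      using comp[OF ts(1)] that sub by blast
    ultimately show ?thesis by (simp add: port_def image_UN)
  qed
  have "graph_iso A.T' B.T' ?\<beta>"
  proof (rule graph_iso_star_tree[where \<U> = "Pow (verts G)"])
    show "inj_on ((`) \<phi>) (Pow (verts G))" using inj by (rule inj_on_image_Pow)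
    show "port G D c t s \<in> Pow (verts G)" if "adj A.T t s" for t s
      using A.port[OF that] limb_in by auto
    show "limbs G D c t \<subseteq> Pow (verts G)" for t using limb_in by blast
  qed (use alpha limbs ports limb_in A.is_graph_T in auto)
  moreover have "\<phi> ` bag A.D' x = bag B.D' (?\<beta> x)" if x: "x \<in> verts A.T'" for x
  proof -
    obtain t K where eq: "x = (t, K)" by fastforce
    then have t: "t \<in> verts A.T" and K: "K \<subseteq> verts G"
      using x limb_in by (auto simp: verts_star_tree)
    have sub: "K \<union> neighbourhood G K \<subseteq> verts G" using K by (auto simp: neighbourhood_def)
    have "\<phi> ` ((K \<union> neighbourhood G K) \<inter> bag D t) =
        (\<phi> ` K \<union> neighbourhood G' (\<phi> ` K)) \<inter> bag D' (\<alpha> t)"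
      using mem(1)[OF sub A.bag_in_verts[OF t]]
      by (simp add: bags[OF t] graph_iso_neighbourhood[OF iso K, symmetric] image_Un)
    then show ?thesis using cores[OF t] by (simp add: eq A.bag_split_dec B.bag_split_dec)
  qed
  ultimately show ?thesis by (auto simp: A.tree_split_dec B.tree_split_dec)
qed


section \<open>Blocks\<close>

lemma ecard_mono: "X \<subseteq> Y \<Longrightarrow> ecard X \<le> ecard Y"
  by (auto simp: ecard_def card_mono finite_subset)

text \<open>Let \<open>\<sigma>\<close> be a star with interior \<open>b\<close>. A vertex \<open>z\<close> of \<open>K\<close> lies outside \<open>b\<close>, hence in
  \<open>A - B\<close> for some \<open>(A, B) \<in> \<sigma>\<close>. The star property gives \<open>A \<subseteq> D\<close> for all other \<open>(C, D) \<in> \<sigma>\<close>, and so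
  \<open>A \<inter> B \<subseteq> b\<close>. Thus \<open>K\<close>, which avoids \<open>b\<close>, cannot leave \<open>A - B\<close>, and its neighbours in
  \<open>b\<close> are among the fewer than \<open>k\<close> vertices of \<open>A \<inter> B\<close>.\<close>

lemma separable_block_not_in_neighbourhood:
  assumes G: "is_graph G" and b: "separable_block G b" and K: "K \<in> components (del_verts G b)"
  shows "\<not> b \<subseteq> neighbourhood G K"
proof
  assume sub: "b \<subseteq> neighbourhood G K"
  obtain k \<sigma> where k: "is_k_block G k b" and star: "is_star G \<sigma>"
    and small: "\<sigma> \<subseteq> oriented_seps (enat k) G" and int: "star_interior G \<sigma> = b"
    using b by (auto simp: separable_block_def)
  note comp = component_of_deletion[OF G K]
  obtain z where z: "z \<in> K" using comp(1) by blast
  then have "z \<in> verts G" "z \<notin> star_interior G \<sigma>" using comp(2) int by auto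
  then obtain A B where AB: "(A, B) \<in> \<sigma>" "z \<notin> B" by (auto simp: star_interior_def)
  then have sep: "A \<union> B = verts G" "\<And>u v. u \<in> A - B \<Longrightarrow> v \<in> B - A \<Longrightarrow> \<not> adj G u v"
    and order: "ecard (A \<inter> B) < enat k"
    using small by (auto simp: oriented_seps_def oriented_sep_def)
  have inter: "A \<inter> B \<subseteq> b"
  proof -
    have "A \<inter> B \<subseteq> D" if "(C, D) \<in> \<sigma>" for C D
    proof (cases "(A, B) = (C, D)")
      case False
      then have "sep_le (A, B) (D, C)" using star AB(1) that by (auto simp: is_star_def)
      then show ?thesis by (auto simp: sep_le_def)
    qed auto
    then show ?thesis using sep(1) by (auto simp: int[symmetric] star_interior_def)
  qed
  have in_A: "w \<in> A" if "u \<in> A - B" "adj G u w" for u w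
    using sep that adj_in_verts(2)[OF G that(2)] by blast
  have "K \<subseteq> A - B"
    unfolding comp(4)[OF z]
  proof (rule component_subset)
    show "z \<in> A - B" using AB(2) \<open>z \<in> verts G\<close> sep(1) by blast
    fix u w assume "u \<in> A - B" "adj (del_verts G b) u w"
    then show "w \<in> A - B" using in_A inter by (auto simp: adj_del_verts[OF G])
  qed
  then have "neighbourhood G K \<subseteq> A" using in_A by (auto simp: neighbourhood_def)
  moreover have "b \<subseteq> B" using AB(1) by (auto simp: int[symmetric] star_interior_def)
  ultimately have "b \<subseteq> A \<inter> B" using sub by blast
  then have "ecard b < enat k" using ecard_mono order le_less_trans by blast
  then show False using k by (auto simp: is_k_block_def)
qed

text \<open>Every bag lies on one side of the distinguishing edge. The block that is oriented to the other
  side would be contained in both sides, but the order of the separation is less than the size of either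
  block.\<close>

lemma distinguished_blocks_not_in_common_bag:
  assumes dec: "tree_decomposition G D" and dist: "distinguishes G D b b'"
    and s: "s \<in> verts (tree D)" and sub: "b \<subseteq> bag D s" "b' \<subseteq> bag D s"
  shows False
proof -
  obtain k k' A B where k: "is_k_block G k b" "is_k_block G k' b'"
    and AB: "{A, B} \<in> induced_seps D" and o: "(A, B) \<in> block_orientation G k b"
    "(B, A) \<in> block_orientation G k' b'"
    using dist by (auto simp: distinguishes_def)
  obtain e where e: "e \<in> edges (tree D)" "{A, B} = side D e ` e"
    using AB by (auto simp: induced_seps_def edge_sep_def)
  have T: "is_graph (tree D)" "connected_graph (tree D)"
    using dec by (auto simp: tree_decomposition_def is_tree_def)
  obtain t t' where t: "e = {t, t'}" "t \<in> verts (tree D)"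
    using T(1) e by (auto simp: is_graph_def card_2_iff)
  have "bag D s \<subseteq> side D e t \<or> bag D s \<subseteq> side D e t'"
    using connected_del_edge_cover[OF T(2) t(2) s, of t'] by (auto simp: side_def t(1))
  then have "bag D s \<subseteq> A \<or> bag D s \<subseteq> B" using e(2) by (auto simp: t(1) doubleton_eq_iff)
  then have "b \<subseteq> A \<inter> B \<or> b' \<subseteq> B \<inter> A" using o sub by (auto simp: block_orientation_def)
  moreover have "ecard (A \<inter> B) < enat k" "ecard (B \<inter> A) < enat k'"
    using o by (auto simp: block_orientation_def oriented_seps_def)
  ultimately have "ecard b < enat k \<or> ecard b' < enat k'"
    using ecard_mono le_less_trans by blast
  then show False using k by (auto simp: is_k_block_def)
qed

text \<open>If \<open>bag D t\<close> includes exactly one member of \<open>\<B>\<close>, this is that block, and if it includes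
  none, this is the whole bag. The intersection avoids choosing a block, which makes the definition
  visibly invariant under isomorphisms.\<close>

definition block_core :: "'a set set \<Rightarrow> ('n, 'a) tree_dec \<Rightarrow> 'n \<Rightarrow> 'a set" where
  "block_core \<B> D t = bag D t \<inter> \<Inter>{b \<in> \<B>. b \<subseteq> bag D t}"

lemma block_core_iso:
  assumes inj: "inj_on \<phi> V" and B: "\<And>b. b \<in> \<B> \<Longrightarrow> b \<subseteq> V" and bag: "bag D t \<subseteq> V"
    and bag': "bag D' t' = \<phi> ` bag D t"
  shows "block_core ((`) \<phi> ` \<B>) D' t' = \<phi> ` block_core \<B> D t"
proof -
  have sub: "\<phi> ` b \<subseteq> \<phi> ` bag D t \<longleftrightarrow> b \<subseteq> bag D t" if "b \<in> \<B>" for b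
    using inj_on_image_mem_iff[OF inj _ bag] B[OF that] by blast
  have "{b \<in> (`) \<phi> ` \<B>. b \<subseteq> bag D' t'} = (`) \<phi> ` {b \<in> \<B>. b \<subseteq> bag D t}"
    using sub by (auto simp: bag')
  moreover have "\<phi> x \<in> \<phi> ` b \<longleftrightarrow> x \<in> b" if "b \<in> \<B>" "x \<in> bag D t" for x b
    using inj_on_image_mem_iff[OF inj _ B[OF that(1)]] that bag by blast
  ultimately show ?thesis unfolding block_core_def bag' by auto
qed

theorem theorem3:
  fixes \<G> :: "'a ugraph set"
    and \<B> :: "'a ugraph \<Rightarrow> 'a set set"
    and D :: "'a ugraph \<Rightarrow> ('n, 'a) tree_dec"
  assumes graphs: "\<And>G. G \<in> \<G> \<Longrightarrow> is_graph G"
    and blocks: "\<And>G b. G \<in> \<G> \<Longrightarrow> b \<in> \<B> G \<Longrightarrow> separable_block G b"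
    and decomposition: "\<And>G. G \<in> \<G> \<Longrightarrow> tree_decomposition G (D G)"
    and tight: "\<And>G. G \<in> \<G> \<Longrightarrow> tight_dec G (D G)"
    and distinguished: "\<And>G b b'. G \<in> \<G> \<Longrightarrow> b \<in> \<B> G \<Longrightarrow> b' \<in> \<B> G \<Longrightarrow> b \<noteq> b' \<Longrightarrow>
      distinguishes G (D G) b b'"
    and home: "\<And>G b. G \<in> \<G> \<Longrightarrow> b \<in> \<B> G \<Longrightarrow> in_unique_bag (D G) b"
  shows "\<exists>\<Psi> :: 'a ugraph \<Rightarrow> ('n \<times> 'a set, 'a) tree_dec.
    (\<forall>G\<in>\<G>. tree_decomposition G (\<Psi> G) \<and> refines (\<Psi> G) (D G) \<and>
      (\<forall>b\<in>\<B> G. \<exists>t\<in>verts (tree (\<Psi> G)). bag (\<Psi> G) t = b \<and>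
        (\<forall>s\<in>verts (tree (\<Psi> G)). b \<subseteq> bag (\<Psi> G) s \<longrightarrow> s = t))) \<and>
    (canonical_sets \<G> \<B> \<and> canonical_dec \<G> D \<longrightarrow> canonical_dec \<G> \<Psi>)"

proof (intro exI conjI ballI impI)
  let ?c = "\<lambda>G. block_core (\<B> G) (D G)"
  let ?\<Psi> = "\<lambda>G. split_dec G (D G) (?c G)"
  have split: "bag_splitting G (D G) (?c G)" if "G \<in> \<G>" for G
    using that graphs decomposition tight by unfold_locales (auto simp: block_core_def)
  fix G assume G: "G \<in> \<G>"
  interpret bag_splitting G "D G" "?c G" using split[OF G] .
  show "tree_decomposition G (?\<Psi> G)" by (rule tree_decomposition_split_dec)
  show "refines (?\<Psi> G) (D G)" by (rule refines_split_dec)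
  fix b assume b: "b \<in> \<B> G"
  obtain t where t: "t \<in> verts T" "b \<subseteq> bag (D G) t"
    and unique: "\<And>s. s \<in> verts T \<Longrightarrow> b \<subseteq> bag (D G) s \<Longrightarrow> s = t"
    using home[OF G b] by (auto simp: in_unique_bag_def)
  have "{b' \<in> \<B> G. b' \<subseteq> bag (D G) t} = {b}"
    using distinguished_blocks_not_in_common_bag[OF dec distinguished[OF G] t(1)] b t by auto
  then have core_t: "?c G t = b" using t by (auto simp: block_core_def)
  show "\<exists>x\<in>verts (tree (?\<Psi> G)). bag (?\<Psi> G) x = b \<and>
    (\<forall>y\<in>verts (tree (?\<Psi> G)). b \<subseteq> bag (?\<Psi> G) y \<longrightarrow> y = x)"
  proof (intro bexI[of _ "(t, {})"] conjI ballI impI)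
    show "bag (?\<Psi> G) (t, {}) = b" by (simp add: bag_split_dec core_t)
    show "(t, {}) \<in> verts (tree (?\<Psi> G))" using t by (simp add: tree_split_dec verts_star_tree)
    fix y assume y: "y \<in> verts (tree (?\<Psi> G))" and sub: "b \<subseteq> bag (?\<Psi> G) y"
    obtain s K where eq: "y = (s, K)" by fastforce
    have y': "(s, K) \<in> verts T'" using y by (simp add: eq tree_split_dec)
    then have "s = t"
      using unique[of s] bag_split_subset[OF y'] sub by (auto simp: eq verts_star_tree)
    have "K = {}"
    proof (rule ccontr)
      assume "K \<noteq> {}"
      then have K: "K \<in> components (del_verts G b)"
        using y' by (simp add: verts_star_tree limbs_def \<open>s = t\<close> core_t)
      have "b \<subseteq> neighbourhood G K"
        using sub \<open>K \<noteq> {}\<close> component_of_deletion(2)[OF graph K] by (auto simp: eq bag_split_dec)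
      then show False
        using separable_block_not_in_neighbourhood[OF graph blocks[OF G b] K] by blast
    qed
    then show "y = (t, {})" by (simp add: eq \<open>s = t\<close>)
  qed
next
  let ?c = "\<lambda>G. block_core (\<B> G) (D G)"
  let ?\<Psi> = "\<lambda>G. split_dec G (D G) (?c G)"
  have split: "bag_splitting G (D G) (?c G)" if "G \<in> \<G>" for G
    using that graphs decomposition tight by unfold_locales (auto simp: block_core_def)
  assume can: "canonical_sets \<G> \<B> \<and> canonical_dec \<G> D"
  show "canonical_dec \<G> ?\<Psi>"
    unfolding canonical_dec_def
  proof (intro ballI allI impI)
    fix G G' \<phi> assume G: "G \<in> \<G>" "G' \<in> \<G>" and iso: "graph_iso G G' \<phi>"
    obtain \<alpha> where alpha: "graph_iso (tree (D G)) (tree (D G')) \<alpha>"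
      "\<And>t. t \<in> verts (tree (D G)) \<Longrightarrow> bag (D G') (\<alpha> t) = \<phi> ` bag (D G) t"
      using can G iso unfolding canonical_dec_def by metis
    have B': "\<B> G' = (`) \<phi> ` \<B> G" using can G iso by (simp add: canonical_sets_def)
    have inj: "inj_on \<phi> (verts G)" using iso by (simp add: graph_iso_def bij_betw_def)
    have cores: "?c G' (\<alpha> t) = \<phi> ` ?c G t" if t: "t \<in> verts (tree (D G))" for t
      unfolding B'
    proof (rule block_core_iso[OF inj])
      show "b \<subseteq> verts G" if "b \<in> \<B> G" for b
        using blocks[OF G(1) that] by (auto simp: separable_block_def is_k_block_def)
      show "bag (D G) t \<subseteq> verts G"
        using decomposition[OF G(1)] t by (auto simp: tree_decomposition_def)
    qed (rule alpha(2)[OF t])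
    show "\<exists>\<beta>. graph_iso (tree (?\<Psi> G)) (tree (?\<Psi> G')) \<beta> \<and>
      (\<forall>x\<in>verts (tree (?\<Psi> G)). \<phi> ` bag (?\<Psi> G) x = bag (?\<Psi> G') (\<beta> x))"
      by (rule split_dec_iso[OF split[OF G(1)] split[OF G(2)] iso alpha cores])
  qed
qed

end
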